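(* Let $\mathcal A$ be a unital Banach algebra with a one-parameter automorphism group acting on it, with generator $\delta$. Let $M=(M_k)_{k\ge0}$ be an algebra sequence and set $P_k=M_k/k!$. For $m\in\mathbb N$ put $$A_m=\sup\Bigl\{\Bigl(P_k^{-1}\prod_{j=1}^mP_{l_j}\Bigr)^{1/m}: k\in\mathbb N,\ l_j\ge1\text{ for }1\le j\le m,\ \sum_{j=1}^ml_j=k\Bigr\}.$$ If $\lim_{m\to\infty}A_m=0$, then the Dales-Davie algebra $D^1_M(\mathcal A)$ is inverse-closed in $\mathcal A$, i.e. every $a\in D^1_M(\mathcal A)$ that is invertible in $\mathcal A$ satisfies $a^{-1}\in D^1_M(\mathcal A)$.
   Context: A one-parameter automorphism group on $\mathcal A$ is a family $\{\psi_t\}_{t\in\mathbb R}$ of Banach algebra automorphisms with $\psi_s\psi_t=\psi_{s+t}$ and $\sup_t\|\psi_t\|_{\mathcal A\to\mathcal A}<\infty$. Its generator is $\delta(a)=\lim_{h\to0}(\psi_h(a)-a)/h$, with domain the set of $a$ for which the norm limit exists. An algebra sequence is a sequence of positive numbers $M=(M_k)_{k\ge0}$ with $M_0=1$ and $\frac{M_{k+l}}{(k+l)!}\ge\frac{M_k}{k!}\frac{M_l}{l!}$ for all $k,l\in\mathbb N_0$. $D^1_M(\mathcal A)$ is the set of $a\in\mathcal A$ for which $\delta^k(a)$ is defined for all $k\ge0$ and $\|a\|_{D^1_M(\mathcal A)}=\sum_{k=0}^\infty M_k^{-1}\|\delta^k(a)\|_{\mathcal A}<\infty$. *)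

theory Defs
  imports "HOL-Analysis.Analysis"
begin

text \<open>
  The unital Banach algebra is a type of sort
  \<open>{real_normed_algebra, ring_1, banach}\<close>. Scalars are real: a complex Banach algebra is in
  particular a real one, a complex-linear automorphism is real-linear, and nothing below
  refers to the scalar field otherwise. The normalisation \<open>norm 1 = 1\<close> is not imposed.
\<close>

text \<open>Boundedness of the inverse and \<open>f 1 = 1\<close> follow from the conditions below.\<close>

definition banach_algebra_automorphism :: "('a::{real_normed_algebra, ring_1, banach} \<Rightarrow> 'a) \<Rightarrow> bool"
  where "banach_algebra_automorphism f \<longleftrightarrow>
    bounded_linear f \<and> bij f \<and> (\<forall>x y. f (x * y) = f x * f y)"

text \<open>No strong continuity in \<open>t\<close> is assumed.\<close>

definition one_parameter_automorphism_group ::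
    "(real \<Rightarrow> 'a::{real_normed_algebra, ring_1, banach} \<Rightarrow> 'a) \<Rightarrow> bool"
  where "one_parameter_automorphism_group \<psi> \<longleftrightarrow>
    (\<forall>t. banach_algebra_automorphism (\<psi> t)) \<and>
    (\<forall>s t. \<psi> s \<circ> \<psi> t = \<psi> (s + t)) \<and>
    bdd_above (range (\<lambda>t. onorm (\<psi> t)))"

definition generator_domain :: "(real \<Rightarrow> 'a::{real_normed_algebra, ring_1, banach} \<Rightarrow> 'a) \<Rightarrow> 'a set"
  where "generator_domain \<psi> = {a. \<exists>b. ((\<lambda>h. (\<psi> h a - a) /\<^sub>R h) \<longlongrightarrow> b) (at 0)}"

text \<open>Unspecified outside \<open>generator_domain \<psi>\<close>.\<close>

definition generator :: "(real \<Rightarrow> 'a::{real_normed_algebra, ring_1, banach} \<Rightarrow> 'a) \<Rightarrow> 'a \<Rightarrow> 'a"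
  where "generator \<psi> a = Lim (at 0) (\<lambda>h. (\<psi> h a - a) /\<^sub>R h)"

definition algebra_sequence :: "(nat \<Rightarrow> real) \<Rightarrow> bool"
  where "algebra_sequence M \<longleftrightarrow>
    (\<forall>k. M k > 0) \<and> M 0 = 1 \<and>
    (\<forall>k l. M (k + l) / fact (k + l) \<ge> M k / fact k * (M l / fact l))"

text \<open>
  The first condition says that every power of the generator is defined at \<open>a\<close>, the second
  that the norm series of \<open>a\<close> is finite.
\<close>

definition dales_davie ::
    "(real \<Rightarrow> 'a::{real_normed_algebra, ring_1, banach} \<Rightarrow> 'a) \<Rightarrow> (nat \<Rightarrow> real) \<Rightarrow> 'a set"
  where "dales_davie \<psi> M =
    {a. (\<forall>k. (generator \<psi> ^^ k) a \<in> generator_domain \<psi>) \<and>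
        summable (\<lambda>k. inverse (M k) * norm ((generator \<psi> ^^ k) a))}"

definition inverse_closed :: "'a::monoid_mult set \<Rightarrow> bool"
  where "inverse_closed B \<longleftrightarrow> (\<forall>a\<in>B. \<forall>b. a * b = 1 \<and> b * a = 1 \<longrightarrow> b \<in> B)"

definition A_set :: "(nat \<Rightarrow> real) \<Rightarrow> nat \<Rightarrow> real set"
  where "A_set P m =
    {root m (inverse (P k) * (\<Prod>j=1..m. P (l j))) | k l.
       (\<forall>j\<in>{1..m}. l j \<ge> 1) \<and> (\<Sum>j=1..m. l j) = k}"

definition A_seq :: "(nat \<Rightarrow> real) \<Rightarrow> nat \<Rightarrow> real"
  where "A_seq P m = Sup (A_set P m)"

text \<open>
  For an algebra sequence the real supremum in \<open>A_seq\<close> is a genuine one for every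
  \<open>m \<ge> 1\<close>: the set is nonempty and bounded above by 1. The value at \<open>m = 0\<close>, where the
  exponent \<open>1/m\<close> makes no sense, is immaterial for the limit.
\<close>

lemma prod_le_of_supermultiplicative:
  fixes P :: "nat \<Rightarrow> real" and l :: "nat \<Rightarrow> nat" and m :: nat
  assumes "P 0 = 1" "\<And>k. P k > 0" "\<And>k l. P k * P l \<le> P (k + l)"
  shows "(\<Prod>j=1..m. P (l j)) \<le> P (\<Sum>j=1..m. l j)"
proof (induction m)
  case 0
  then show ?case using assms(1) by simp
next
  case (Suc m)
  have "(\<Prod>j=1..Suc m. P (l j)) = (\<Prod>j=1..m. P (l j)) * P (l (Suc m))"
    by simp
  also have "\<dots> \<le> P (\<Sum>j=1..m. l j) * P (l (Suc m))"
    using Suc assms(2)[of "l (Suc m)"] by (intro mult_right_mono) auto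
  also have "\<dots> \<le> P ((\<Sum>j=1..m. l j) + l (Suc m))"
    by (rule assms(3))
  finally show ?case by simp
qed

lemma A_set_nonempty: "A_set P m \<noteq> {}"
proof -
  have "root m (inverse (P m) * (\<Prod>j=1..m. P 1)) \<in> A_set P m"
    unfolding A_set_def by (rule CollectI, rule exI[of _ m], rule exI[of _ "\<lambda>_. 1"]) simp
  then show ?thesis by blast
qed

lemma A_set_le_1:
  assumes "algebra_sequence M" "x \<in> A_set (\<lambda>k. M k / fact k) m" "m \<ge> 1"
  shows "x \<le> 1"
proof -
  define P where "P = (\<lambda>k. M k / fact k)"
  have pos: "P k > 0" for k
    using assms(1) by (simp add: P_def algebra_sequence_def)
  obtain l where x: "x = root m (inverse (P (\<Sum>j=1..m. l j)) * (\<Prod>j=1..m. P (l j)))"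
    using assms(2) unfolding A_set_def P_def by blast
  have "(\<Prod>j=1..m. P (l j)) \<le> P (\<Sum>j=1..m. l j)"
    using assms(1) pos
    by (intro prod_le_of_supermultiplicative) (auto simp: P_def algebra_sequence_def)
  then have "inverse (P (\<Sum>j=1..m. l j)) * (\<Prod>j=1..m. P (l j)) \<le> 1"
    using pos[of "\<Sum>j=1..m. l j"] by (simp add: field_simps)
  then show ?thesis
    using x assms(3) by simp
qed

end

theory Submission
  imports Defs
begin

text \<open>
  Write \<open>a\<^sub>k = \<delta>\<^sup>k a / k!\<close>. By the Leibniz rule \<open>a \<mapsto> \<Sum>a\<^sub>k t\<^sup>k\<close> is multiplicative, so for \<open>b = a\<^sup>-\<^sup>1\<close> the
  norms \<open>\<beta>\<^sub>n\<close>, \<open>\<alpha>\<^sub>n\<close> of \<open>b\<^sub>n\<close>, \<open>a\<^sub>n\<close> satisfy \<open>\<beta>\<^sub>n \<le> c \<Sum>\<^sub>i\<^sub><\<^sub>n \<beta>\<^sub>i \<alpha>\<^sub>n\<^sub>-\<^sub>i\<close> with \<open>c = \<beta>\<^sub>0\<close>. Iterating,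
  \<open>\<beta>\<^sub>n\<close> is at most the sum over \<open>m\<close> of \<open>c\<^sup>m\<^sup>+\<^sup>1\<close> times the \<open>m\<close>-fold convolution power of \<open>(\<alpha>\<^sub>k)\<^sub>k\<^sub>\<ge>\<^sub>1\<close> at \<open>n\<close>.
  Dividing by \<open>P\<^sub>n\<close> turns \<open>\<alpha>\<^sub>k\<close> into \<open>\<alpha>\<^sub>k / P\<^sub>k\<close> at the cost of a factor \<open>A\<^sub>m\<^sup>m\<close>, so that
  \<open>\<Sum> \<beta>\<^sub>n / P\<^sub>n \<le> \<Sum> c\<^sup>m\<^sup>+\<^sup>1 A\<^sub>m\<^sup>m S\<^sup>m\<close> with \<open>S = \<Sum>\<^sub>k\<^sub>\<ge>\<^sub>1 \<alpha>\<^sub>k / P\<^sub>k\<close>, which converges by the root test.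
\<close>

section \<open>The generator as a derivation\<close>

locale automorphism_group =
  fixes \<psi> :: "real \<Rightarrow> 'a::{real_normed_algebra, ring_1, banach} \<Rightarrow> 'a"
  assumes group: "one_parameter_automorphism_group \<psi>"
begin

abbreviation \<delta> where "\<delta> \<equiv> generator \<psi>"

lemma linear: "linear (\<psi> t)" and mult: "\<psi> t (x * y) = \<psi> t x * \<psi> t y"
  and bij: "bij (\<psi> t)" and bounded_linear: "bounded_linear (\<psi> t)"
  using group unfolding one_parameter_automorphism_group_def banach_algebra_automorphism_def
  by (auto simp: bounded_linear.linear)

lemma one: "\<psi> t 1 = 1"
proof -
  obtain u where "\<psi> t u = 1"
    using bij by (metis bij_pointE)
  then show ?thesis
    using mult[of t u 1] by simp
qed

text \<open>Limits at 0 are unique, so a single limit statement settles membership in the domain and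
  the value of \<open>\<delta>\<close> together.\<close>

lemma has_generator_iff:
  "x \<in> generator_domain \<psi> \<and> \<delta> x = d \<longleftrightarrow> ((\<lambda>h. (\<psi> h x - x) /\<^sub>R h) \<longlongrightarrow> d) (at 0)"
  (is "_ \<longleftrightarrow> (?D \<longlongrightarrow> d) _")
proof -
  have "Lim (at 0) ?D = l" if "(?D \<longlongrightarrow> l) (at 0)" for l
    using that by (intro tendsto_Lim) simp_all
  then show ?thesis
    unfolding generator_domain_def generator_def by blast
qed

lemmas has_generatorI = has_generator_iff[THEN iffD2]

lemma tendsto_generator:
  "x \<in> generator_domain \<psi> \<Longrightarrow> ((\<lambda>h. (\<psi> h x - x) /\<^sub>R h) \<longlongrightarrow> \<delta> x) (at 0)"
  using has_generator_iff by blast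

text \<open>Strong continuity is not assumed, so continuity of the orbit at 0 is extracted from
  differentiability there.\<close>

lemma tendsto_orbit:
  assumes "x \<in> generator_domain \<psi>"
  shows "((\<lambda>h. \<psi> h x) \<longlongrightarrow> x) (at 0)"
proof -
  have "((\<lambda>h. x + h *\<^sub>R ((\<psi> h x - x) /\<^sub>R h)) \<longlongrightarrow> x + 0 *\<^sub>R \<delta> x) (at 0)"
    by (intro tendsto_intros tendsto_generator assms)
  then have "((\<lambda>h. x + h *\<^sub>R ((\<psi> h x - x) /\<^sub>R h)) \<longlongrightarrow> x) (at 0)"
    by simp
  then show ?thesis
    by (rule Lim_transform_eventually) (auto simp: eventually_at_filter)
qed

lemma generator_add:
  assumes "x \<in> generator_domain \<psi>" "y \<in> generator_domain \<psi>"
  shows "x + y \<in> generator_domain \<psi> \<and> \<delta> (x + y) = \<delta> x + \<delta> y"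
proof (rule has_generatorI)
  show "((\<lambda>h. (\<psi> h (x + y) - (x + y)) /\<^sub>R h) \<longlongrightarrow> \<delta> x + \<delta> y) (at 0)"
    using tendsto_add[OF assms[THEN tendsto_generator]]
    by (simp add: linear_add[OF linear] algebra_simps)
qed

lemma generator_minus:
  assumes "x \<in> generator_domain \<psi>"
  shows "- x \<in> generator_domain \<psi> \<and> \<delta> (- x) = - \<delta> x"
proof (rule has_generatorI)
  show "((\<lambda>h. (\<psi> h (- x) - (- x)) /\<^sub>R h) \<longlongrightarrow> - \<delta> x) (at 0)"
    using tendsto_minus[OF tendsto_generator[OF assms]]
    by (simp add: linear_neg[OF linear] algebra_simps)
qed

lemma generator_mult:
  assumes "x \<in> generator_domain \<psi>" "y \<in> generator_domain \<psi>"
  shows "x * y \<in> generator_domain \<psi> \<and> \<delta> (x * y) = \<delta> x * y + x * \<delta> y"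
proof (rule has_generatorI)
  have "((\<lambda>h. ((\<psi> h x - x) /\<^sub>R h) * y + \<psi> h x * ((\<psi> h y - y) /\<^sub>R h)) \<longlongrightarrow> \<delta> x * y + x * \<delta> y) (at 0)"
    by (intro tendsto_intros tendsto_generator tendsto_orbit assms)
  then show "((\<lambda>h. (\<psi> h (x * y) - x * y) /\<^sub>R h) \<longlongrightarrow> \<delta> x * y + x * \<delta> y) (at 0)"
    by (simp add: mult algebra_simps)
qed

lemma generator_one: "1 \<in> generator_domain \<psi> \<and> \<delta> 1 = 0"
  by (rule has_generatorI) (simp add: one)

lemma orbit_bounded: "\<exists>K. \<forall>h. norm (\<psi> h x) \<le> K"
proof -
  obtain C where C: "onorm (\<psi> t) \<le> C" for t
    using group unfolding one_parameter_automorphism_group_def bdd_above_def by auto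
  have "norm (\<psi> h x) \<le> C * norm x" for h
    using onorm[OF bounded_linear, of h x] C[of h] mult_right_mono[OF C norm_ge_zero]
    by (meson order_trans)
  then show ?thesis by blast
qed

text \<open>Since \<open>b\<close> is not yet known to lie in the domain,
  \<open>tendsto_orbit\<close> does not apply to it. The identity \<open>diff\<close> and the
  uniform bound on its orbit first give continuity at 0; dividing \<open>diff\<close> by
  \<open>h\<close> then gives the derivative.\<close>

lemma generator_inverse:
  assumes a: "a \<in> generator_domain \<psi>" and "a * b = 1" "b * a = 1"
  shows "b \<in> generator_domain \<psi> \<and> \<delta> b = - (b * \<delta> a * b)"
proof (rule has_generatorI)
  have diff: "\<psi> h b - b = \<psi> h b * (a - \<psi> h a) * b" for h
  proof -
    have inv: "\<psi> h b * \<psi> h a = 1"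
      using mult[of h b a] assms one by simp
    have "\<psi> h b * (a - \<psi> h a) * b = \<psi> h b * (a * b) - (\<psi> h b * \<psi> h a) * b"
      by (simp only: left_diff_distrib right_diff_distrib mult.assoc)
    then show ?thesis
      using assms inv by simp
  qed
  obtain K where K: "norm (\<psi> h b) \<le> K" for h
    using orbit_bounded by blast
  have "((\<lambda>h. K * norm (a - \<psi> h a) * norm b) \<longlongrightarrow> K * norm (a - a) * norm b) (at 0)"
    by (intro tendsto_intros tendsto_orbit a)
  then have lim: "((\<lambda>h. K * norm (a - \<psi> h a) * norm b) \<longlongrightarrow> 0) (at 0)"
    by simp
  have "norm (\<psi> h b - b) \<le> K * norm (a - \<psi> h a) * norm b" for h
    unfolding diff
    by (intro norm_mult_ineq[THEN order_trans] mult_right_mono mult_right_mono[OF K]) auto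
  then have "((\<lambda>h. \<psi> h b - b) \<longlongrightarrow> 0) (at 0)"
    by (intro Lim_null_comparison[OF _ lim] always_eventually allI)
  then have "((\<lambda>h. \<psi> h b) \<longlongrightarrow> b) (at 0)"
    by (simp add: LIM_zero_iff)
  then have "((\<lambda>h. - (\<psi> h b * ((\<psi> h a - a) /\<^sub>R h) * b)) \<longlongrightarrow> - (b * \<delta> a * b)) (at 0)"
    by (intro tendsto_intros tendsto_generator a)
  then show "((\<lambda>h. (\<psi> h b - b) /\<^sub>R h) \<longlongrightarrow> - (b * \<delta> a * b)) (at 0)"
    unfolding diff by (simp add: algebra_simps)
qed

section \<open>Powers of the generator\<close>

text \<open>Finite-order domains make induction on the order possible. The recursion peels off the
  innermost \<open>\<delta>\<close>, so the rules for sums, products and inverses apply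
  directly.\<close>

primrec domain_pow :: "nat \<Rightarrow> 'a set" where
  "domain_pow 0 = UNIV"
| "domain_pow (Suc n) = {x \<in> generator_domain \<psi>. \<delta> x \<in> domain_pow n}"

lemma domain_pow_iff: "x \<in> domain_pow n \<longleftrightarrow> (\<forall>k<n. (\<delta> ^^ k) x \<in> generator_domain \<psi>)"
  by (induction n arbitrary: x) (auto simp: All_less_Suc2 funpow_swap1)

lemma domain_pow_Suc_subset: "x \<in> domain_pow (Suc n) \<Longrightarrow> x \<in> domain_pow n"
  by (simp add: domain_pow_iff del: domain_pow.simps)

lemma domain_pow_add: "\<lbrakk>x \<in> domain_pow n; y \<in> domain_pow n\<rbrakk> \<Longrightarrow> x + y \<in> domain_pow n"
  by (induction n arbitrary: x y) (auto simp: generator_add)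

lemma domain_pow_minus: "x \<in> domain_pow n \<Longrightarrow> - x \<in> domain_pow n"
  by (induction n arbitrary: x) (auto simp: generator_minus)

lemma domain_pow_mult: "\<lbrakk>x \<in> domain_pow n; y \<in> domain_pow n\<rbrakk> \<Longrightarrow> x * y \<in> domain_pow n"
proof (induction n arbitrary: x y)
  case (Suc n)
  note domain_pow_Suc_subset[OF Suc.prems(1)] domain_pow_Suc_subset[OF Suc.prems(2)]
  with Suc show ?case
    by (auto simp: generator_mult intro!: domain_pow_add)
qed simp

text \<open>Bootstrapping: \<open>\<delta> b = - (b * \<delta> a * b)\<close> involves only
  \<open>b\<close>, of order \<open>n\<close> by induction, and \<open>\<delta> a\<close>, so it has
  order \<open>n\<close> too.\<close>

lemma domain_pow_inverse:
  assumes "a * b = 1" "b * a = 1"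
  shows "a \<in> domain_pow n \<Longrightarrow> b \<in> domain_pow n"
proof (induction n)
  case (Suc n)
  with domain_pow_Suc_subset have "b \<in> domain_pow n" by blast
  with Suc.prems assms show ?case
    by (auto simp: generator_inverse intro!: domain_pow_minus domain_pow_mult)
qed simp

section \<open>Taylor coefficients and the Leibniz rule\<close>

definition taylor :: "'a \<Rightarrow> nat \<Rightarrow> 'a" where
  "taylor x n = (\<delta> ^^ n) x /\<^sub>R fact n"

lemma taylor_0 [simp]: "taylor x 0 = x"
  by (simp add: taylor_def)

lemma taylor_generator: "taylor (\<delta> x) n = real (Suc n) *\<^sub>R taylor x (Suc n)"
  unfolding taylor_def funpow_Suc_right o_def fact_Suc
  by (simp del: of_nat_Suc of_nat_add)

lemma taylor_add:
  "\<lbrakk>x \<in> domain_pow n; y \<in> domain_pow n\<rbrakk> \<Longrightarrow> taylor (x + y) n = taylor x n + taylor y n"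
proof (induction n arbitrary: x y)
  case (Suc n)
  then have "real (Suc n) *\<^sub>R taylor (x + y) (Suc n)
      = real (Suc n) *\<^sub>R (taylor x (Suc n) + taylor y (Suc n))"
    by (simp add: taylor_generator[symmetric] generator_add scaleR_add_right del: of_nat_Suc)
  then show ?case by (simp del: of_nat_Suc)
qed simp

text \<open>Applying \<open>\<delta>\<close> once to the product gives two sums over the same terms
  \<open>t i\<close>, with weights \<open>i\<close> and \<open>Suc n - i\<close>. The weights add up
  to \<open>Suc n\<close>, which cancels, so no binomial identities are needed.\<close>

lemma taylor_mult:
  "\<lbrakk>x \<in> domain_pow n; y \<in> domain_pow n\<rbrakk> \<Longrightarrow>
    taylor (x * y) n = (\<Sum>i\<le>n. taylor x i * taylor y (n - i))"
proof (induction n arbitrary: x y)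
  case (Suc n)
  note dom = Suc.prems[THEN domain_pow_Suc_subset]
  define t where "t i = taylor x i * taylor y (Suc n - i)" for i
  have "real (Suc n) *\<^sub>R taylor (x * y) (Suc n) = taylor (\<delta> x * y + x * \<delta> y) n"
    using Suc.prems by (simp add: taylor_generator[symmetric] generator_mult del: of_nat_Suc)
  also have "\<dots> = taylor (\<delta> x * y) n + taylor (x * \<delta> y) n"
    using Suc.prems dom by (intro taylor_add domain_pow_mult) auto
  also have "taylor (\<delta> x * y) n = (\<Sum>i\<le>n. real (Suc i) *\<^sub>R t (Suc i))"
    using Suc.prems dom by (subst Suc.IH) (auto simp: t_def taylor_generator)
  \<comment> \<open>The added term \<open>i = 0\<close> has weight 0; in the other sum the same
    holds for \<open>i = Suc n\<close>.\<close>
  also have "\<dots> = (\<Sum>i\<le>Suc n. real i *\<^sub>R t i)"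
    by (subst sum.atMost_Suc_shift) simp
  also have "taylor (x * \<delta> y) n = (\<Sum>i\<le>n. real (Suc n - i) *\<^sub>R t i)"
    using Suc.prems dom
    by (subst Suc.IH)
       (auto simp: t_def taylor_generator Suc_diff_le simp del: of_nat_Suc intro!: sum.cong)
  also have "\<dots> = (\<Sum>i\<le>Suc n. real (Suc n - i) *\<^sub>R t i)"
    by simp
  also have "(\<Sum>i\<le>Suc n. real i *\<^sub>R t i) + (\<Sum>i\<le>Suc n. real (Suc n - i) *\<^sub>R t i)
      = real (Suc n) *\<^sub>R (\<Sum>i\<le>Suc n. t i)"
    unfolding scaleR_sum_right sum.distrib[symmetric] scaleR_add_left[symmetric] of_nat_add[symmetric]
    by (intro sum.cong) auto
  finally show ?case by (simp add: t_def del: of_nat_Suc)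
qed simp

lemma taylor_one: "n > 0 \<Longrightarrow> taylor 1 n = 0"
proof -
  assume "n > 0"
  then obtain k where n: "n = Suc k" by (cases n) auto
  have "0 \<in> generator_domain \<psi> \<and> \<delta> 0 = 0"
    by (rule has_generatorI) (simp add: linear_0[OF linear])
  then have "(\<delta> ^^ k) 0 = 0"
    by (induction k) auto
  then show ?thesis
    using generator_one by (simp add: taylor_def n funpow_swap1)
qed

text \<open>The coefficient of order \<open>n\<close> of \<open>b * a = 1\<close> vanishes. Its top
  term is \<open>taylor b n * a\<close>, and multiplying by \<open>b\<close> on the right isolates
  \<open>taylor b n\<close>.\<close>

lemma taylor_inverse:
  assumes "a * b = 1" "b * a = 1" "a \<in> domain_pow n" "n > 0"
  shows "taylor b n = - (\<Sum>i<n. taylor b i * taylor a (n - i)) * b"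
proof -
  have "(\<Sum>i\<le>n. taylor b i * taylor a (n - i)) = 0"
    using taylor_mult[OF domain_pow_inverse[OF assms(1-3)] assms(3)] assms taylor_one by simp
  then have "taylor b n * a = - (\<Sum>i<n. taylor b i * taylor a (n - i))"
    by (simp add: lessThan_Suc_atMost[symmetric] eq_neg_iff_add_eq_0 add.commute)
  then have "taylor b n * a * b = - (\<Sum>i<n. taylor b i * taylor a (n - i)) * b"
    by simp
  then show ?thesis
    using assms by (simp add: mult.assoc)
qed

lemma norm_taylor_inverse:
  assumes "a * b = 1" "b * a = 1" "a \<in> domain_pow n" "n > 0"
  shows "norm (taylor b n) \<le> norm b * (\<Sum>i<n. norm (taylor b i) * norm (taylor a (n - i)))"
proof -
  have "norm (taylor b n) \<le> norm (\<Sum>i<n. taylor b i * taylor a (n - i)) * norm b"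
    unfolding taylor_inverse[OF assms] using norm_mult_ineq by (metis norm_minus_cancel)
  also have "\<dots> \<le> (\<Sum>i<n. norm (taylor b i) * norm (taylor a (n - i))) * norm b"
    by (intro mult_right_mono sum_norm_le norm_mult_ineq) simp
  finally show ?thesis by (simp add: mult.commute)
qed

end

lemma dales_davie_iff:
  assumes "automorphism_group \<psi>" "\<And>k. P k = M k / fact k"
  shows "x \<in> dales_davie \<psi> M \<longleftrightarrow> (\<forall>n. x \<in> automorphism_group.domain_pow \<psi> n) \<and>
    summable (\<lambda>k. norm (automorphism_group.taylor \<psi> x k) / P k)"
proof -
  interpret automorphism_group \<psi> by fact
  have "norm (taylor x k) / P k = inverse (M k) * norm ((\<delta> ^^ k) x)" for k
    by (simp add: taylor_def assms(2) field_simps)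
  then show ?thesis
    unfolding dales_davie_def by (auto simp: domain_pow_iff)
qed

section \<open>Convolution powers\<close>

text \<open>The value \<open>u 0\<close> never enters: all parts are positive.\<close>

primrec conv_pow :: "(nat \<Rightarrow> real) \<Rightarrow> nat \<Rightarrow> nat \<Rightarrow> real" where
  "conv_pow u 0 n = (if n = 0 then 1 else 0)"
| "conv_pow u (Suc m) n = (\<Sum>i<n. conv_pow u m i * u (n - i))"

lemma conv_pow_nonneg: "(\<And>k. u k \<ge> 0) \<Longrightarrow> conv_pow u m n \<ge> 0"
  by (induction m arbitrary: n) (auto intro!: sum_nonneg)

text \<open>The hypothesis \<open>step\<close> is fed into itself: for \<open>n \<le> Suc N\<close>
  every \<open>i < n\<close> is at most \<open>N\<close>. Truncating at any
  \<open>N \<ge> n\<close>, rather than at \<open>n\<close>, lets one \<open>N\<close> serve all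
  \<open>n\<close> in a later double sum.\<close>

lemma renewal_bound:
  fixes \<alpha> \<beta> :: "nat \<Rightarrow> real"
  assumes "\<And>k. \<alpha> k \<ge> 0" "c \<ge> 0" "\<beta> 0 \<le> c"
    and step: "\<And>n. n > 0 \<Longrightarrow> \<beta> n \<le> c * (\<Sum>i<n. \<beta> i * \<alpha> (n - i))"
  shows "n \<le> N \<Longrightarrow> \<beta> n \<le> (\<Sum>m\<le>N. c ^ Suc m * conv_pow \<alpha> m n)"
proof (induction N arbitrary: n)
  case 0
  then show ?case using assms by simp
next
  case (Suc N)
  show ?case
  proof (cases "n = 0")
    case True
    have "\<beta> 0 \<le> (\<Sum>m\<le>0. c ^ Suc m * conv_pow \<alpha> m 0)"
      using assms by simp
    also have "\<dots> \<le> (\<Sum>m\<le>Suc N. c ^ Suc m * conv_pow \<alpha> m 0)"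
      using assms by (intro sum_mono2) (auto intro!: mult_nonneg_nonneg conv_pow_nonneg sum_nonneg)
    finally show ?thesis using True by simp
  next
    case False
    have "\<beta> n \<le> c * (\<Sum>i<n. \<beta> i * \<alpha> (n - i))"
      using False step by simp
    also have "\<dots> \<le> c * (\<Sum>i<n. (\<Sum>m\<le>N. c ^ Suc m * conv_pow \<alpha> m i) * \<alpha> (n - i))"
      using assms Suc by (intro mult_left_mono sum_mono mult_right_mono) auto
    also have "\<dots> = (\<Sum>m\<le>N. c ^ Suc (Suc m) * conv_pow \<alpha> (Suc m) n)"
      unfolding conv_pow.simps sum_distrib_left sum_distrib_right
      by (subst sum.swap) (simp add: mult_ac)
    also have "\<dots> = (\<Sum>m\<le>Suc N. c ^ Suc m * conv_pow \<alpha> m n)"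
      using False by (subst sum.atMost_Suc_shift) simp
    finally show ?thesis .
  qed
qed

text \<open>\<open>conv_pow \<alpha> m n\<close> sums products of \<open>\<alpha>\<close> over the
  compositions of \<open>n\<close> into \<open>m\<close> positive parts. Each product is one of
  values of \<open>P\<close>, at most \<open>C\<close>, times one of values of
  \<open>\<alpha> k / P k\<close>. Splitting off the last part turns \<open>C\<close> into
  \<open>C / P (n - i)\<close>.\<close>

lemma conv_pow_le_weighted:
  assumes "\<And>k. P k > 0" "\<And>k. \<alpha> k \<ge> 0"
    and "\<And>l. \<lbrakk>\<forall>j\<in>{1..m}. l j \<ge> 1; (\<Sum>j=1..m. l j) = n\<rbrakk> \<Longrightarrow> (\<Prod>j=1..m. P (l j)) \<le> C"
  shows "conv_pow \<alpha> m n \<le> C * conv_pow (\<lambda>k. \<alpha> k / P k) m n"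
  using assms(3)
proof (induction m arbitrary: n C)
  case 0
  then show ?case by auto
next
  case (Suc m)
  have "conv_pow \<alpha> m i * \<alpha> (n - i) \<le> C * (conv_pow (\<lambda>k. \<alpha> k / P k) m i * (\<alpha> (n - i) / P (n - i)))"
    if "i < n" for i
  proof -
    have "conv_pow \<alpha> m i \<le> C / P (n - i) * conv_pow (\<lambda>k. \<alpha> k / P k) m i"
    proof (rule Suc.IH)
      fix l :: "nat \<Rightarrow> nat"
      assume l: "\<forall>j\<in>{1..m}. l j \<ge> 1" "(\<Sum>j=1..m. l j) = i"
      have "(\<Prod>j=1..Suc m. P ((l(Suc m := n - i)) j)) \<le> C"
        using l that by (intro Suc.prems) auto
      then show "(\<Prod>j=1..m. P (l j)) \<le> C / P (n - i)"
        using assms(1)[of "n - i"] by (simp add: pos_le_divide_eq)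
    qed
    from mult_right_mono[OF this assms(2)[of "n - i"]] show ?thesis
      by (simp add: field_simps)
  qed
  then show ?case
    by (auto simp: sum_distrib_left intro!: sum_mono)
qed

text \<open>Submultiplicativity of the l1 norm under convolution, on partial sums.\<close>

lemma sum_conv_pow_le:
  assumes "\<And>k. u k \<ge> 0" "summable u"
  shows "(\<Sum>n\<le>N. conv_pow u m n) \<le> suminf u ^ m"
proof (induction m)
  case 0
  then show ?case by (simp add: sum.delta)
next
  case (Suc m)
  have "(\<Sum>n\<le>N. conv_pow u (Suc m) n)
      = (\<Sum>(n, i)\<in>Sigma {..N} (\<lambda>n. {..<n}). conv_pow u m i * u (n - i))"
    by (simp add: sum.Sigma)
  \<comment> \<open>The pairs \<open>(i, n - i)\<close> are distinct and lie in a square, where the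
    sum factorises.\<close>
  also have "\<dots> = (\<Sum>(i, j)\<in>(\<lambda>(n, i). (i, n - i)) ` Sigma {..N} (\<lambda>n. {..<n}). conv_pow u m i * u j)"
    by (subst sum.reindex) (auto simp: inj_on_def case_prod_unfold)
  also have "\<dots> \<le> (\<Sum>(i, j)\<in>{..N} \<times> {..N}. conv_pow u m i * u j)"
    using assms by (intro sum_mono2) (auto intro!: mult_nonneg_nonneg conv_pow_nonneg)
  also have "\<dots> = (\<Sum>i\<le>N. conv_pow u m i) * (\<Sum>j\<le>N. u j)"
    by (simp add: sum_product sum.cartesian_product)
  also have "\<dots> \<le> suminf u ^ m * suminf u"
    using assms by (intro mult_mono Suc sum_le_suminf)
      (auto intro!: sum_nonneg suminf_nonneg zero_le_power)
  finally show ?case by (simp add: mult.commute)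
qed

section \<open>The weight condition\<close>

lemma prod_le_A_seq_power:
  assumes M: "algebra_sequence M" and P: "\<And>k. P k = M k / fact k"
    and l: "\<forall>j\<in>{1..m}. l j \<ge> 1" "(\<Sum>j=1..m. l j) = n"
  shows "(\<Prod>j=1..m. P (l j)) \<le> A_seq P m ^ m * P n"
proof (cases "m = 0")
  \<comment> \<open>The empty composition forces \<open>n = 0\<close>, and both sides are 1.\<close>
  case True
  then show ?thesis using M P l by (simp add: algebra_sequence_def)
next
  case False
  have P_eq: "P = (\<lambda>k. M k / fact k)" using P by blast
  have pos: "P k > 0" for k using M P by (simp add: algebra_sequence_def)
  define r where "r = inverse (P n) * (\<Prod>j=1..m. P (l j))"
  have "r \<ge> 0" unfolding r_def using pos by (auto intro!: mult_nonneg_nonneg prod_nonneg simp: less_imp_le)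
  have "root m r \<in> A_set P m"
    unfolding A_set_def r_def using l by blast
  moreover have "bdd_above (A_set P m)"
    using A_set_le_1[OF M] False P_eq by (intro bdd_aboveI[of _ 1]) auto
  ultimately have "root m r \<le> A_seq P m"
    unfolding A_seq_def by (rule cSup_upper)
  then have "root m r ^ m \<le> A_seq P m ^ m"
    using \<open>r \<ge> 0\<close> False by (intro power_mono real_root_ge_zero)
  then have "r \<le> A_seq P m ^ m"
    using \<open>r \<ge> 0\<close> False by simp
  then show ?thesis
    using pos[of n] by (simp add: r_def field_simps)
qed

lemma A_seq_nonneg:
  assumes "algebra_sequence M" "\<And>k. P k = M k / fact k"
  shows "A_seq P m \<ge> 0"
proof (cases "m = 0")
  case True
  \<comment> \<open>By convention \<open>root 0\<close> is constantly 0, so the supremum is over the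
    set containing only 0.\<close>
  then show ?thesis by (simp add: A_seq_def A_set_def)
next
  case False
  have P_eq: "P = (\<lambda>k. M k / fact k)" using assms by blast
  have pos: "P k > 0" for k using assms by (simp add: algebra_sequence_def)
  obtain x where x: "x \<in> A_set P m" using A_set_nonempty by blast
  then have "x \<ge> 0"
    using pos unfolding A_set_def
    by (auto intro!: mult_nonneg_nonneg prod_nonneg real_root_ge_zero simp: less_imp_le)
  moreover have "bdd_above (A_set P m)"
    using A_set_le_1[OF assms(1)] False P_eq by (intro bdd_aboveI[of _ 1]) auto
  ultimately show ?thesis
    unfolding A_seq_def using x by (meson cSup_upper order_trans)
qed

lemma summable_power_mult_null:
  fixes A :: "nat \<Rightarrow> real"
  assumes "A \<longlonglongrightarrow> 0"
  shows "summable (\<lambda>m. (A m * s) ^ m)"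
proof -
  have "(\<lambda>m. \<bar>A m * s\<bar>) \<longlonglongrightarrow> 0"
    using tendsto_rabs[OF tendsto_mult_right[OF assms, of s]] by simp
  then have "\<forall>\<^sub>F m in sequentially. \<bar>A m * s\<bar> < 1/2"
    by (rule order_tendstoD) simp
  then have "\<forall>\<^sub>F m in sequentially. norm ((A m * s) ^ m) \<le> (1/2) ^ m"
  proof eventually_elim
    case (elim m)
    then have "\<bar>A m * s\<bar> ^ m \<le> (1/2) ^ m"
      by (intro power_mono) auto
    then show ?case by (simp add: power_abs)
  qed
  then show ?thesis
    by (rule summable_comparison_test_ev) (simp add: summable_geometric)
qed

section \<open>Summation and inverse-closedness\<close>

text \<open>The terms are nonnegative, so it suffices to bound the partial sums independently of
  \<open>N\<close>; the bound is \<open>c * suminf q\<close>.\<close>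

lemma summable_renewal:
  fixes \<alpha> \<beta> :: "nat \<Rightarrow> real"
  assumes M: "algebra_sequence M" and P: "\<And>k. P k = M k / fact k"
    and A: "(\<lambda>m. A_seq P m) \<longlonglongrightarrow> 0"
    and \<alpha>: "\<And>k. \<alpha> k \<ge> 0" "summable (\<lambda>k. \<alpha> k / P k)"
    and \<beta>: "\<And>k. \<beta> k \<ge> 0" "\<And>n. n > 0 \<Longrightarrow> \<beta> n \<le> \<beta> 0 * (\<Sum>i<n. \<beta> i * \<alpha> (n - i))"
  shows "summable (\<lambda>k. \<beta> k / P k)"
proof -
  define \<gamma> where "\<gamma> k = \<alpha> k / P k" for k
  define c where "c = \<beta> 0"
  define S where "S = suminf \<gamma>"
  have pos: "P k > 0" for k using M P by (simp add: algebra_sequence_def)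
  have \<gamma>: "\<gamma> k \<ge> 0" "summable \<gamma>" for k
    using \<alpha> pos[of k] by (auto simp: \<gamma>_def[abs_def])
  have c: "c \<ge> 0" and S: "S \<ge> 0"
    using \<beta> \<gamma> by (auto simp: c_def S_def intro!: suminf_nonneg)
  define q where "q m = (A_seq P m * (c * S)) ^ m" for m
  have q: "q m \<ge> 0" "summable q" for m
    using A_seq_nonneg[OF M P, of m] c S summable_power_mult_null[OF A]
    by (auto simp: q_def[abs_def])
  have weight: "conv_pow \<alpha> m n / P n \<le> A_seq P m ^ m * conv_pow \<gamma> m n" for m n
  proof -
    have "conv_pow \<alpha> m n \<le> A_seq P m ^ m * P n * conv_pow (\<lambda>k. \<alpha> k / P k) m n"
      by (rule conv_pow_le_weighted[OF pos \<alpha>(1) prod_le_A_seq_power[OF M P]])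
    then show ?thesis
      using pos[of n] by (simp add: \<gamma>_def[abs_def] pos_divide_le_eq mult_ac)
  qed
  have "(\<Sum>n\<le>N. \<beta> n / P n) \<le> c * suminf q" for N
  proof -
    have "(\<Sum>n\<le>N. \<beta> n / P n) \<le> (\<Sum>n\<le>N. (\<Sum>m\<le>N. c ^ Suc m * conv_pow \<alpha> m n) / P n)"
    proof (intro sum_mono divide_right_mono)
      fix n assume "n \<in> {..N}"
      then show "\<beta> n \<le> (\<Sum>m\<le>N. c ^ Suc m * conv_pow \<alpha> m n)"
        using \<alpha> \<beta> c by (intro renewal_bound) (auto simp: c_def)
    qed (use pos in \<open>simp add: less_imp_le\<close>)
    also have "\<dots> = (\<Sum>m\<le>N. \<Sum>n\<le>N. c ^ Suc m * (conv_pow \<alpha> m n / P n))"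
      by (subst sum.swap) (simp add: sum_divide_distrib)
    also have "\<dots> \<le> (\<Sum>m\<le>N. \<Sum>n\<le>N. c ^ Suc m * (A_seq P m ^ m * conv_pow \<gamma> m n))"
      using c by (intro sum_mono mult_left_mono weight) auto
    also have "\<dots> = (\<Sum>m\<le>N. c ^ Suc m * A_seq P m ^ m * (\<Sum>n\<le>N. conv_pow \<gamma> m n))"
      by (simp add: sum_distrib_left mult_ac)
    also have "\<dots> \<le> (\<Sum>m\<le>N. c ^ Suc m * A_seq P m ^ m * S ^ m)"
      unfolding S_def using c A_seq_nonneg[OF M P]
      by (intro sum_mono mult_left_mono sum_conv_pow_le \<gamma>) auto
    also have "\<dots> = c * (\<Sum>m\<le>N. q m)"
      by (simp add: sum_distrib_left q_def power_mult_distrib mult_ac)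
    also have "\<dots> \<le> c * suminf q"
      using c q by (intro mult_left_mono sum_le_suminf) auto
    finally show ?thesis .
  qed
  then show ?thesis
    using \<beta> pos by (intro bounded_imp_summable) (auto simp: less_imp_le)
qed

theorem theorem32:
  fixes \<psi> :: "real \<Rightarrow> 'a::{real_normed_algebra, ring_1, banach} \<Rightarrow> 'a"
    and M P :: "nat \<Rightarrow> real"
  assumes "one_parameter_automorphism_group \<psi>"
    and "algebra_sequence M"
    and "\<And>k. P k = M k / fact k"
    and "(\<lambda>m. A_seq P m) \<longlonglongrightarrow> 0"
  shows "inverse_closed (dales_davie \<psi> M)"
  unfolding inverse_closed_def
proof (intro ballI allI impI)
  interpret automorphism_group \<psi> by unfold_locales fact
  note iff = dales_davie_iff[OF automorphism_group_axioms assms(3)]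
  fix a b
  assume "a \<in> dales_davie \<psi> M" and inv: "a * b = 1 \<and> b * a = 1"
  then have dom: "a \<in> domain_pow n" and sum: "summable (\<lambda>k. norm (taylor a k) / P k)" for n
    using iff by auto
  have "summable (\<lambda>k. norm (taylor b k) / P k)"
    \<comment> \<open>Here \<open>\<beta> 0\<close> is \<open>norm (taylor b 0)\<close>, that is
      \<open>norm b\<close>, the constant in \<open>norm_taylor_inverse\<close>.\<close>
    using inv dom norm_taylor_inverse[of a b]
    by (intro summable_renewal[OF assms(2-4) _ sum]) auto
  with inv dom show "b \<in> dales_davie \<psi> M"
    using iff domain_pow_inverse by blast
qed

end
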